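(* Let $p$ and $q$ be distinct primes, let $G$ be a cyclic group of order $p^2q^2$ with identity $e_G$, let $S_1=\{x\in G: |x|=p \text{ or } |x|=q\}$, $S_2=\{x\in G: |x|=p^2 \text{ or } |x|=q^2\}$, $S_3=\{e_G\}$. Then the clique number of the Bi-Cayley graph $\Gamma=\mathrm{BiCay}(G;S_1,S_2,S_3)$ is $\max\{p,q\}$.
   Context: $|x|$ denotes the order of the element $x$. For a group $G$ and nonempty subsets $S_1,S_2,S_3\subseteq G$ with $S_1,S_2,S_3$ inverse-closed and $e_G\notin S_1\cup S_2$, the Bi-Cayley graph $\mathrm{BiCay}(G;S_1,S_2,S_3)$ is the simple graph with vertex set $\{0,1\}\times G$ in which two distinct vertices $(i,x),(j,y)$ are adjacent iff: $xy^{-1}\in S_1$ when $i=j=0$; $xy^{-1}\in S_2$ when $i=j=1$; $xy^{-1}\in S_3$ when $i\ne j$. *)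

theory Defs
  imports
    "HOL-Algebra.Elementary_Groups"
    "HOL-Algebra.Multiplicative_Group"
    "HOL-Computational_Algebra.Primes"
    "HOL-Library.Ramsey"
begin

text \<open>
  Simple graphs are given by a vertex set and a set of two-element edges, which is
  the representation used by \<^const>\<open>clique\<close>.
\<close>

definition clique_number :: "'v set \<Rightarrow> 'v set set \<Rightarrow> nat"
  where "clique_number V E = Max (card ` {K. K \<subseteq> V \<and> clique K E})"

text \<open>The standing assumptions on the three connection sets of a Bi-Cayley graph.\<close>

definition bicay_sets ::
    "('a, 'b) monoid_scheme \<Rightarrow> 'a set \<Rightarrow> 'a set \<Rightarrow> 'a set \<Rightarrow> bool"
  where "bicay_sets G S1 S2 S3 \<longleftrightarrow>
    (\<forall>S \<in> {S1, S2, S3}. S \<noteq> {} \<and> S \<subseteq> carrier G \<and> (\<forall>x \<in> S. inv\<^bsub>G\<^esub> x \<in> S)) \<and>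
    \<one>\<^bsub>G\<^esub> \<notin> S1 \<union> S2"

definition bicay_verts :: "('a, 'b) monoid_scheme \<Rightarrow> (nat \<times> 'a) set"
  where "bicay_verts G = {0, 1} \<times> carrier G"

fun bicay_adj ::
    "('a, 'b) monoid_scheme \<Rightarrow> 'a set \<Rightarrow> 'a set \<Rightarrow> 'a set \<Rightarrow> nat \<times> 'a \<Rightarrow> nat \<times> 'a \<Rightarrow> bool"
  where "bicay_adj G S1 S2 S3 (i, x) (j, y) \<longleftrightarrow>
    (i = 0 \<and> j = 0 \<and> x \<otimes>\<^bsub>G\<^esub> inv\<^bsub>G\<^esub> y \<in> S1) \<or>
    (i = 1 \<and> j = 1 \<and> x \<otimes>\<^bsub>G\<^esub> inv\<^bsub>G\<^esub> y \<in> S2) \<or>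
    (i \<noteq> j \<and> x \<otimes>\<^bsub>G\<^esub> inv\<^bsub>G\<^esub> y \<in> S3)"

definition bicay_edges ::
    "('a, 'b) monoid_scheme \<Rightarrow> 'a set \<Rightarrow> 'a set \<Rightarrow> 'a set \<Rightarrow> (nat \<times> 'a) set set"
  where "bicay_edges G S1 S2 S3 =
    {{u, v} | u v. u \<in> bicay_verts G \<and> v \<in> bicay_verts G \<and> u \<noteq> v \<and> bicay_adj G S1 S2 S3 u v}"

text \<open>
  Under the standing assumptions the adjacency condition is symmetric, so passing to
  unordered pairs adds no edges.
\<close>

lemma bicay_adj_sym:
  assumes "group G" "bicay_sets G S1 S2 S3"
    and "u \<in> bicay_verts G" "v \<in> bicay_verts G" "bicay_adj G S1 S2 S3 u v"
  shows "bicay_adj G S1 S2 S3 v u"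
proof -
  interpret group G by fact
  obtain i x j y where uv: "u = (i, x)" "v = (j, y)" by (cases u, cases v) auto
  have xy: "x \<in> carrier G" "y \<in> carrier G"
    using assms(3,4) uv by (auto simp: bicay_verts_def)
  have "inv\<^bsub>G\<^esub> (x \<otimes>\<^bsub>G\<^esub> inv\<^bsub>G\<^esub> y) = y \<otimes>\<^bsub>G\<^esub> inv\<^bsub>G\<^esub> x"
    using xy by (simp add: inv_mult_group)
  moreover have "\<forall>S \<in> {S1, S2, S3}. \<forall>z \<in> S. inv\<^bsub>G\<^esub> z \<in> S"
    using assms(2) by (auto simp: bicay_sets_def)
  ultimately have "\<forall>S \<in> {S1, S2, S3}. x \<otimes>\<^bsub>G\<^esub> inv\<^bsub>G\<^esub> y \<in> S \<longrightarrow> y \<otimes>\<^bsub>G\<^esub> inv\<^bsub>G\<^esub> x \<in> S"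
    by metis
  then show ?thesis using assms(5) uv by auto
qed

lemma bicay_edges_iff:
  assumes "group G" "bicay_sets G S1 S2 S3" "u \<in> bicay_verts G" "v \<in> bicay_verts G"
  shows "{u, v} \<in> bicay_edges G S1 S2 S3 \<longleftrightarrow> u \<noteq> v \<and> bicay_adj G S1 S2 S3 u v"
  unfolding bicay_edges_def mem_Collect_eq doubleton_eq_iff
  using assms(3,4) bicay_adj_sym[OF assms(1,2)] by blast

text \<open>The sets of elements of prime and of prime-square order are admissible.\<close>

lemma bicay_sets_prime_orders:
  fixes p q :: nat
  assumes "prime p" "prime q" "group G" "cyclic_group G" "order G = p\<^sup>2 * q\<^sup>2"
  shows "bicay_sets G
    {x \<in> carrier G. group.ord G x = p \<or> group.ord G x = q}
    {x \<in> carrier G. group.ord G x = p\<^sup>2 \<or> group.ord G x = q\<^sup>2}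
    {\<one>\<^bsub>G\<^esub>}"
proof -
  interpret group G by fact
  have gt: "p > 1" "q > 1" using assms(1,2) by (simp_all only: prime_gt_1_nat)
  then have gt2: "p\<^sup>2 > 1" "q\<^sup>2 > 1" by (simp_all only: one_less_power zero_less_numeral)
  obtain g where g: "g \<in> carrier G" "subgroup_generated G {g} = G"
    using assms(4) by (auto simp: cyclic_group_def)
  have og: "ord g = p\<^sup>2 * q\<^sup>2"
    using cyclic_order_is_ord[OF g(1)] g(2) assms(5) by simp
  have ex: "\<exists>x \<in> carrier G. ord x = d" if d: "d dvd p\<^sup>2 * q\<^sup>2" for d
  proof -
    obtain k where k: "p\<^sup>2 * q\<^sup>2 = d * k" using d by blast
    have nz: "p\<^sup>2 * q\<^sup>2 \<noteq> 0" using gt by auto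
    then have "k \<noteq> 0" using k by auto
    moreover have "k dvd ord g" using og k by simp
    ultimately have "ord (g [^]\<^bsub>G\<^esub> k) = ord g div k" using g(1) by (intro ord_pow) auto
    then show ?thesis using og k \<open>k \<noteq> 0\<close> g(1) by auto
  qed
  obtain a b where "a \<in> carrier G" "ord a = p" "b \<in> carrier G" "ord b = p\<^sup>2"
    using ex[of p] ex[of "p\<^sup>2"] by (auto simp: power2_eq_square)
  then show ?thesis using gt gt2 by (auto simp: bicay_sets_def)
qed

end

theory Submission
  imports Defs
begin

text \<open>
  Inside one layer, "the order of \<open>x y\<^sup>-\<^sup>1\<close> divides \<open>n\<close>" is the equivalence relation
  \<open>x\<^sup>n = y\<^sup>n\<close>. A clique inside one layer is therefore covered by two equivalence relations,
  one for each prime, and two equivalence relations whose union is total cannot both be proper.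
  So only one prime \<open>r\<close> occurs, all differences have order \<open>r\<close> (or all have order \<open>r\<^sup>2\<close>), and
  (after raising to the power \<open>r\<close> in the second case) the clique injects into the \<open>r\<close> solutions of
  \<open>z\<^sup>r = 1\<close>. A clique that meets both layers has a single vertex in each of them, because
  an edge between the layers determines one endpoint from the other. The solutions of
  \<open>z\<^sup>r = 1\<close> in the first layer attain the bound.
\<close>

text \<open>For \<open>x = a [^] i\<close> the equation \<open>x [^] d = \<one>\<close> says that
  \<open>d * e\<close> divides \<open>i * d\<close>, which after cancelling \<open>d\<close> means
  that \<open>e\<close> divides \<open>i\<close>.\<close>

lemma (in group) pow_roots_eq_generate:
  assumes a: "a \<in> carrier G" "subgroup_generated G {a} = G" and fin: "finite (carrier G)"
    and d: "order G = d * e"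
  shows "{x \<in> carrier G. x [^] d = \<one>} = generate G {a [^] e}"
proof -
  have oa: "ord a = d * e"
    using cyclic_order_is_ord[OF a(1)] a(2) d by simp
  have d0: "d \<noteq> 0"
    using d fin by (metis mult_is_0 order_gt_0_iff_finite less_numeral_extra(3))
  \<comment> \<open>In a finite group natural exponents suffice to list the cyclic group generated
    by an element.\<close>
  have car: "carrier G = {a [^] k | k::nat. k \<in> UNIV}"
    using generate_pow_on_finite_carrier[OF fin a(1)] a carrier_subgroup_generated[of G "{a}"]
    by simp
  have gen: "generate G {a [^] e} = {(a [^] e) [^] k | k::nat. k \<in> UNIV}"
    using generate_pow_on_finite_carrier[OF fin] a(1) by simp
  show ?thesis
  proof (intro equalityI subsetI)
    fix x assume "x \<in> {x \<in> carrier G. x [^] d = \<one>}"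
    then obtain i :: nat where i: "x = a [^] i" "x [^] d = \<one>"
      using car by auto
    then have "a [^] (i * d) = \<one>"
      using a(1) by (simp add: nat_pow_pow)
    then have "d * e dvd i * d"
      using pow_eq_id[OF a(1)] oa by simp
    then have "e dvd i"
      using d0 by (simp add: mult.commute)
    then obtain j where "i = e * j" by blast
    then show "x \<in> generate G {a [^] e}"
      using gen i(1) a(1) by (auto simp: nat_pow_pow)
  next
    fix x assume "x \<in> generate G {a [^] e}"
    then obtain j :: nat where x: "x = a [^] (e * j)"
      using gen a(1) by (auto simp: nat_pow_pow)
    have "a [^] (e * j * d) = \<one>"
      using pow_eq_id[OF a(1)] oa by simp
    then show "x \<in> {x \<in> carrier G. x [^] d = \<one>}"
      using x a(1) by (simp add: nat_pow_pow)
  qed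
qed

text \<open>The solutions form the subgroup generated by \<open>a [^] e\<close>, whose size is the
  order of that element, \<open>d * e div e\<close>.\<close>

lemma (in group) card_pow_roots:
  assumes "cyclic_group G" and fin: "finite (carrier G)" and "d dvd order G"
  shows "card {x \<in> carrier G. x [^] d = \<one>} = d"
proof -
  obtain a where a: "a \<in> carrier G" "subgroup_generated G {a} = G"
    using assms(1) by (auto simp: cyclic_group_def)
  obtain e where e: "order G = d * e"
    using assms(3) by blast
  have oa: "ord a = d * e"
    using cyclic_order_is_ord[OF a(1)] a(2) e by simp
  have e0: "e \<noteq> 0"
    using e fin by (metis mult_is_0 order_gt_0_iff_finite less_numeral_extra(3))
  have "card (generate G {a [^] e}) = ord (a [^] e)"
    using generate_pow_card a(1) by simp
  also have "\<dots> = d"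
    using ord_pow[of a e] a(1) oa e0 by simp
  finally show ?thesis
    using pow_roots_eq_generate[OF a fin e] by simp
qed

text \<open>Commutativity distributes the power over the quotient. The right-hand side makes
  transitivity in \<open>x\<close> and \<open>y\<close> evident.\<close>

lemma (in comm_group) ord_diff_dvd_iff:
  assumes "x \<in> carrier G" "y \<in> carrier G"
  shows "ord (x \<otimes> inv y) dvd n \<longleftrightarrow> x [^] n = y [^] n"
proof -
  have "ord (x \<otimes> inv y) dvd n \<longleftrightarrow> (x \<otimes> inv y) [^] n = \<one>"
    using assms by (simp add: pow_eq_id)
  also have "(x \<otimes> inv y) [^] n = x [^] n \<otimes> inv (y [^] n)"
    using assms by (simp add: nat_pow_distrib nat_pow_inv)
  also have "x [^] n \<otimes> inv (y [^] n) = \<one> \<longleftrightarrow> x [^] n = y [^] n"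
    using assms by (metis inv_solve_right' l_one nat_pow_closed one_closed)
  finally show ?thesis .
qed

text \<open>Translating by a fixed \<open>w\<close> in \<open>K\<close> and raising to the power
  \<open>r ^ k\<close> sends \<open>K\<close> into the \<open>r\<close> solutions of
  \<open>z [^] r = \<one>\<close>. A collision of distinct points would make
  \<open>r ^ Suc k\<close> divide \<open>r ^ k\<close>.\<close>

lemma (in comm_group) card_diff_ord_prime_power_le:
  assumes "cyclic_group G" and fin: "finite (carrier G)" and r: "r dvd order G" "r > 1"
    and K: "K \<subseteq> carrier G"
    and diff: "\<And>x y. \<lbrakk>x \<in> K; y \<in> K; x \<noteq> y\<rbrakk> \<Longrightarrow> ord (x \<otimes> inv y) = r ^ Suc k"
  shows "card K \<le> r"
proof (cases "K = {}")
  case False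
  then obtain w where w: "w \<in> K" by blast
  define R where "R = {z \<in> carrier G. z [^] r = \<one>}"
  define f where "f x = (x \<otimes> inv w) [^] (r ^ k)" for x
  have "f x \<in> R" if x: "x \<in> K" for x
  proof -
    \<comment> \<open>Only divisibility holds here, since \<open>x = w\<close> gives the identity,
      of order 1.\<close>
    have "ord (x \<otimes> inv w) dvd r ^ Suc k"
      using diff[OF x w] K x w by (cases "x = w") (auto simp: subset_iff)
    moreover have "x \<otimes> inv w \<in> carrier G"
      using K x w by blast
    ultimately show ?thesis
      by (simp add: R_def f_def nat_pow_pow pow_eq_id mult.commute)
  qed
  moreover have "inj_on f K"
  proof (rule inj_onI, rule ccontr)
    fix x y assume xy: "x \<in> K" "y \<in> K" "f x = f y" "x \<noteq> y"
    have c: "x \<in> carrier G" "y \<in> carrier G" "w \<in> carrier G"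
      using K xy w by auto
    have "x [^] (r ^ k) = y [^] (r ^ k)"
      using xy(3) c by (simp add: f_def nat_pow_distrib)
    then have "r ^ Suc k dvd r ^ k"
      using ord_diff_dvd_iff[OF c(1,2)] diff[OF xy(1,2,4)] by metis
    then show False
      using r(2) by (simp add: dvd_power_iff_le del: power_Suc)
  qed
  moreover have "finite R"
    using fin by (simp add: R_def)
  ultimately have "card K \<le> card R"
    by (intro card_inj_on_le[of f]) auto
  then show ?thesis
    using card_pow_roots[OF assms(1) fin r(1)] by (simp add: R_def)
qed simp

text \<open>The case \<open>k = 0\<close> serves the first layer of the graph, the case
  \<open>k = 1\<close> the second.\<close>

lemma (in comm_group) card_diff_ord_two_prime_powers_le:
  assumes G: "cyclic_group G" "finite (carrier G)"
    and r: "r dvd order G" "r > 1" and s: "s dvd order G" "s > 1" and "coprime r s"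
    and K: "K \<subseteq> carrier G"
    and diff: "\<And>x y. \<lbrakk>x \<in> K; y \<in> K; x \<noteq> y\<rbrakk> \<Longrightarrow>
      ord (x \<otimes> inv y) = r ^ Suc k \<or> ord (x \<otimes> inv y) = s ^ Suc k"
  shows "card K \<le> max r s"
proof -
  have ndvd: "\<not> r ^ Suc k dvd s ^ Suc k" "\<not> s ^ Suc k dvd r ^ Suc k"
    using \<open>coprime r s\<close> r(2) s(2)
    by (metis coprime_power_left_iff coprime_power_right_iff coprime_absorb_left coprime_absorb_right
        is_unit_power_iff nat_dvd_1_iff_1 less_irrefl nat.distinct(1))+
  define A where "A x y \<longleftrightarrow> x [^] (r ^ Suc k) = y [^] (r ^ Suc k)" for x y
  define B where "B x y \<longleftrightarrow> x [^] (s ^ Suc k) = y [^] (s ^ Suc k)" for x y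
  have A: "A x y \<longleftrightarrow> ord (x \<otimes> inv y) dvd r ^ Suc k"
    and B: "B x y \<longleftrightarrow> ord (x \<otimes> inv y) dvd s ^ Suc k" if "x \<in> K" "y \<in> K" for x y
    using that K ord_diff_dvd_iff unfolding A_def B_def by (metis subsetD)+
  have AB: "A x y \<or> B x y" if "x \<in> K" "y \<in> K" for x y
    using A[OF that] B[OF that] diff[OF that] by (cases "x = y") (auto simp: A_def)
  have "(\<forall>x\<in>K. \<forall>y\<in>K. A x y) \<or> (\<forall>x\<in>K. \<forall>y\<in>K. B x y)"
  proof (rule ccontr)
    assume "\<not> ?thesis"
    then obtain x y u v where
      xy: "x \<in> K" "y \<in> K" "\<not> A x y" and uv: "u \<in> K" "v \<in> K" "\<not> B u v"
      by blast
    have "B x y" "A u v"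
      using AB xy uv by blast+
    \<comment> \<open>If \<open>A x u\<close>, then also \<open>A x v\<close>; as
      \<open>A x y\<close> fails, \<open>y\<close> is \<open>B\<close>-related to both
      \<open>u\<close> and \<open>v\<close>, so \<open>B u v\<close>. If instead
      \<open>B x u\<close>, then also \<open>B y u\<close>; as \<open>B u v\<close> fails,
      \<open>v\<close> is \<open>A\<close>-related to both \<open>x\<close> and \<open>y\<close>, so
      \<open>A x y\<close>.\<close>
    then show False
      using AB[of x u] AB[of x v] AB[of y u] AB[of y v] xy uv unfolding A_def B_def by metis
  qed
  then show ?thesis
  proof
    assume all: "\<forall>x\<in>K. \<forall>y\<in>K. A x y"
    \<comment> \<open>Every difference now has order dividing \<open>r ^ Suc k\<close>, which
      excludes the order \<open>s ^ Suc k\<close>.\<close>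
    have "card K \<le> r"
      by (rule card_diff_ord_prime_power_le[OF G r K, of k]) (metis A all diff ndvd(2))
    then show ?thesis by simp
  next
    assume all: "\<forall>x\<in>K. \<forall>y\<in>K. B x y"
    have "card K \<le> s"
      by (rule card_diff_ord_prime_power_le[OF G s K, of k]) (metis B all diff ndvd(1))
    then show ?thesis by simp
  qed
qed

lemma bicay_clique_iff:
  assumes "group G" "bicay_sets G S1 S2 S3" "K \<subseteq> bicay_verts G"
  shows "clique K (bicay_edges G S1 S2 S3) \<longleftrightarrow>
    (\<forall>u\<in>K. \<forall>v\<in>K. u \<noteq> v \<longrightarrow> bicay_adj G S1 S2 S3 u v)"
  using assms(3) bicay_edges_iff[OF assms(1,2)] unfolding clique_def by (meson subsetD)

lemma clique_number_eqI:
  assumes "finite V" "K \<subseteq> V" "clique K E" "card K = n"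
    and "\<And>K. \<lbrakk>K \<subseteq> V; clique K E\<rbrakk> \<Longrightarrow> card K \<le> n"
  shows "clique_number V E = n"
  unfolding clique_number_def
proof (rule Max_eqI)
  show "finite (card ` {K. K \<subseteq> V \<and> clique K E})"
    using assms(1) by simp
qed (use assms in auto)

theorem theorem2p14:
  fixes G :: "('a, 'b) monoid_scheme" and p q :: nat and S1 S2 S3 :: "'a set"
  assumes "prime p" and "prime q" and "p \<noteq> q"
    and "group G" and "cyclic_group G" and "order G = p\<^sup>2 * q\<^sup>2"
    and "S1 = {x \<in> carrier G. group.ord G x = p \<or> group.ord G x = q}"
    and "S2 = {x \<in> carrier G. group.ord G x = p\<^sup>2 \<or> group.ord G x = q\<^sup>2}"
    and "S3 = {\<one>\<^bsub>G\<^esub>}"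
  shows "clique_number (bicay_verts G) (bicay_edges G S1 S2 S3) = max p q"
proof -
  interpret comm_group G
    using group.cyclic_imp_abelian_group[OF assms(4,5)] .
  have gt: "p > 1" "q > 1"
    using assms(1,2) by (simp_all only: prime_gt_1_nat)
  have fin: "finite (carrier G)"
    using assms(6) gt order_gt_0_iff_finite by simp
  have dvd: "p dvd order G" "q dvd order G"
    using assms(6) by (simp_all add: power2_eq_square)
  have cop: "coprime p q"
    using assms(1-3) by (simp add: primes_coprime)
  have sets: "bicay_sets G S1 S2 S3"
    using bicay_sets_prime_orders[OF assms(1,2,4,5,6)] assms(7-9) by simp
  note clique_iff = bicay_clique_iff[OF assms(4) sets]
  have finV: "finite (bicay_verts G)"
    using fin by (simp add: bicay_verts_def)
  define t where "t = max p q"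
  have t: "prime t" "t = p \<or> t = q" "t dvd order G"
    using assms(1,2) dvd by (auto simp: t_def max_def)
  define R where "R = {x \<in> carrier G. x [^]\<^bsub>G\<^esub> t = \<one>\<^bsub>G\<^esub>}"
  have "clique ({0} \<times> R) (bicay_edges G S1 S2 S3)"
  proof (subst clique_iff)
    show "{0} \<times> R \<subseteq> bicay_verts G"
      by (auto simp: bicay_verts_def R_def)
    have "x \<otimes>\<^bsub>G\<^esub> inv\<^bsub>G\<^esub> y \<in> S1" if xy: "x \<in> R" "y \<in> R" "x \<noteq> y" for x y
    proof -
      have c: "x \<in> carrier G" "y \<in> carrier G"
        using xy by (auto simp: R_def)
      have "ord (x \<otimes>\<^bsub>G\<^esub> inv\<^bsub>G\<^esub> y) dvd t"
        using ord_diff_dvd_iff[OF c] xy by (simp add: R_def)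
      \<comment> \<open>Order 1 would give \<open>x = y\<close>, by the exponent
        \<open>n = 1\<close> in the equivalence; the prime \<open>t\<close> leaves only order
        \<open>t\<close>.\<close>
      moreover have "ord (x \<otimes>\<^bsub>G\<^esub> inv\<^bsub>G\<^esub> y) \<noteq> 1"
        using ord_diff_dvd_iff[OF c, of 1] c xy(3) by auto
      ultimately have "ord (x \<otimes>\<^bsub>G\<^esub> inv\<^bsub>G\<^esub> y) = t"
        using t(1) prime_nat_iff by blast
      then show ?thesis
        using t(2) c by (auto simp: assms(7))
    qed
    then show "\<forall>u\<in>{0} \<times> R. \<forall>v\<in>{0} \<times> R. u \<noteq> v \<longrightarrow> bicay_adj G S1 S2 S3 u v"
      by auto
  qed
  moreover have "card ({0::nat} \<times> R) = max p q"
    using card_pow_roots[OF assms(5) fin t(3)] by (simp add: R_def t_def card_cartesian_product)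
  moreover have "{0} \<times> R \<subseteq> bicay_verts G"
    by (auto simp: bicay_verts_def R_def)
  moreover have "card K \<le> max p q"
    if K: "K \<subseteq> bicay_verts G" "clique K (bicay_edges G S1 S2 S3)" for K
  proof -
    have adj: "bicay_adj G S1 S2 S3 u v" if "u \<in> K" "v \<in> K" "u \<noteq> v" for u v
      using clique_iff[OF K(1)] K(2) that by blast
    define L where "L i = {x. (i, x) \<in> K}" for i :: nat
    have Lc: "L i \<subseteq> carrier G" for i
      using K(1) by (auto simp: L_def bicay_verts_def)
    then have Lfin: "finite (L i)" for i
      using fin finite_subset by blast
    have KL: "K = {0} \<times> L 0 \<union> {1} \<times> L 1"
      using K(1) by (auto simp: L_def bicay_verts_def)
    have cardK: "card K = card (L 0) + card (L 1)"
      by (subst KL, subst card_Un_disjoint) (auto simp: Lfin card_cartesian_product)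
    have L0: "card (L 0) \<le> max p q"
    proof (rule card_diff_ord_two_prime_powers_le
        [OF assms(5) fin dvd(1) gt(1) dvd(2) gt(2) cop Lc, of _ 0])
      fix x y assume "x \<in> L 0" "y \<in> L 0" "x \<noteq> y"
      then show "ord (x \<otimes>\<^bsub>G\<^esub> inv\<^bsub>G\<^esub> y) = p ^ Suc 0 \<or> ord (x \<otimes>\<^bsub>G\<^esub> inv\<^bsub>G\<^esub> y) = q ^ Suc 0"
        using adj[of "(0, x)" "(0, y)"] by (auto simp: L_def assms(7))
    qed
    have L1: "card (L 1) \<le> max p q"
    proof (rule card_diff_ord_two_prime_powers_le
        [OF assms(5) fin dvd(1) gt(1) dvd(2) gt(2) cop Lc, of _ 1])
      fix x y assume "x \<in> L 1" "y \<in> L 1" "x \<noteq> y"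
      then show "ord (x \<otimes>\<^bsub>G\<^esub> inv\<^bsub>G\<^esub> y) = p ^ Suc 1 \<or> ord (x \<otimes>\<^bsub>G\<^esub> inv\<^bsub>G\<^esub> y) = q ^ Suc 1"
        using adj[of "(1, x)" "(1, y)"] by (auto simp: L_def assms(8) power2_eq_square)
    qed
    have cross: "x = y" if "x \<in> L 0" "y \<in> L 1" for x y
    proof -
      have "x \<otimes>\<^bsub>G\<^esub> inv\<^bsub>G\<^esub> y = \<one>\<^bsub>G\<^esub>"
        using adj[of "(0, x)" "(1, y)"] that by (simp add: L_def assms(9))
      moreover have "x \<in> carrier G" "y \<in> carrier G"
        using that Lc by auto
      ultimately show ?thesis
        using ord_diff_dvd_iff[of x y 1] by simp
    qed
    show ?thesis
    proof (cases "L 0 = {} \<or> L 1 = {}")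
      case True
      then show ?thesis using cardK L0 L1 by auto
    next
      case False
      then obtain x where "L 0 = {x}" "L 1 = {x}"
        using cross by blast
      \<comment> \<open>Such a clique has two vertices, and 2 is at most \<open>max p q\<close>
        because primes exceed 1.\<close>
      then show ?thesis using cardK gt by simp
    qed
  qed
  ultimately show ?thesis
    using clique_number_eqI[OF finV] by blast
qed

end
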